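(* Fix a load factor $\alpha\in[0,1)$ and consider the asymptotic model (described in the context) of an infinite open-addressing hash table with random probing and the Robin Hood collision resolution discipline. For $i\ge 1$ let $q_i(\alpha)=\alpha\,p_i(\alpha)$, where $p_i(\alpha)$ is the probability that a randomly chosen key in the table has age $i$. Then the double tails $\bar{\bar q}_i=\sum_{j\ge i}\sum_{k\ge j} q_k$ satisfy $$\bar{\bar q}_{i+1}=\bar{\bar q}_i-1+e^{-\bar{\bar q}_i}\qquad(i\ge 1),$$ with initial condition $\bar{\bar q}_1=\ln\frac{1}{1-\alpha}$.
   Context: Asymptotic model: the table has $m$ slots and $n$ keys with $n,m\to\infty$ and $n/m=\alpha$ fixed. Each key $x$ has an infinite probe sequence $h_1(x),h_2(x),\dots$ of i.i.d. integers uniform on $\{0,\dots,m-1\}$; keys are inserted one at a time, and a key stored at position $h_j(x)$ has age $j$. Under Robin Hood, when two keys compete for a slot the collision is resolved in favor of the key with larger age (the loser continues to its next probe). For a sequence $a_i$ ($i\ge1$) its tail is $\bar a_i=\sum_{j\ge i}a_j$, and $\bar{\bar a}_i$ is the tail of the tail. In this model, letting $t_i(\alpha)$ denote the expected number of probes made by keys of age $i$ during one insertion into an $\alpha$-full table, one has $t_1=1$, $\bar t_1=\frac1{1-\alpha}$, $\partial_\alpha \bar q_i(\alpha)=t_i(\alpha)$ with $q_i(0)=0$, and for Robin Hood $\bar t_{i+1}=\bar t_i\,\bar q_i$. *)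

theory Defs
  imports "HOL-Probability.Probability"
begin

text \<open>
  Keys and slots are natural numbers.  A table maps a slot to the key stored there together with
  the age of that key; \<open>h (x, j)\<close> is the \<open>j\<close>-th probe (\<open>j \<ge> 1\<close>) of key \<open>x\<close>.
\<close>

type_synonym table = "nat \<Rightarrow> (nat \<times> nat) option"

text \<open>
  The discipline does not say who wins between keys of equal age, so the rule for ties is a
  parameter: \<open>tie x y\<close> means that an arriving key \<open>x\<close> evicts a resident \<open>y\<close> of the same age.
\<close>

definition evicts :: "(nat \<Rightarrow> nat \<Rightarrow> bool) \<Rightarrow> nat \<times> nat \<Rightarrow> nat \<times> nat \<Rightarrow> bool" where
  "evicts tie = (\<lambda>(x, j) (y, k). k < j \<or> k = j \<and> tie x y)"

text \<open>
  Key \<open>x\<close> makes its \<open>j\<close>-th probe into \<open>T\<close>, and probing goes on until an empty slot is found.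
  The value is \<open>None\<close> if probing never ends; for a table that is not full this has probability 0.
\<close>

partial_function (option) rh_probe ::
    "(nat \<Rightarrow> nat \<Rightarrow> bool) \<Rightarrow> (nat \<times> nat \<Rightarrow> nat) \<Rightarrow> table \<Rightarrow> nat \<Rightarrow> nat \<Rightarrow> table option" where
  "rh_probe tie h T x j =
    (case T (h (x, j)) of
       None \<Rightarrow> Some (T(h (x, j) \<mapsto> (x, j)))
     | Some (y, k) \<Rightarrow>
         if evicts tie (x, j) (y, k)
         then rh_probe tie h (T(h (x, j) \<mapsto> (x, j))) y (Suc k)
         else rh_probe tie h T x (Suc j))"

text \<open>The table after the keys \<open>0, \<dots>, n - 1\<close> have been inserted in this order.\<close>

fun rh_table :: "(nat \<Rightarrow> nat \<Rightarrow> bool) \<Rightarrow> (nat \<times> nat \<Rightarrow> nat) \<Rightarrow> nat \<Rightarrow> table option" where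
  "rh_table tie h 0 = Some Map.empty"
| "rh_table tie h (Suc n) = Option.bind (rh_table tie h n) (\<lambda>T. rh_probe tie h T n 1)"

definition has_age ::
    "(nat \<Rightarrow> nat \<Rightarrow> bool) \<Rightarrow> (nat \<times> nat \<Rightarrow> nat) \<Rightarrow> nat \<Rightarrow> nat \<Rightarrow> nat \<Rightarrow> bool" where
  "has_age tie h n x i \<longleftrightarrow> (\<exists>T s. rh_table tie h n = Some T \<and> T s = Some (x, i))"

definition probe_space :: "nat \<Rightarrow> (nat \<times> nat \<Rightarrow> nat) measure" where
  "probe_space m = Pi\<^sub>M UNIV (\<lambda>_. measure_pmf (pmf_of_set {..<m}))"

text \<open>
  The probability that a key chosen uniformly among the \<open>n\<close> keys, independently of the probe
  sequences, has age \<open>i\<close> in a table with \<open>m\<close> slots.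
\<close>

definition age_prob :: "(nat \<Rightarrow> nat \<Rightarrow> bool) \<Rightarrow> nat \<Rightarrow> nat \<Rightarrow> nat \<Rightarrow> real" where
  "age_prob tie n m i =
     measure (measure_pmf (pmf_of_set {..<n}) \<Otimes>\<^sub>M probe_space m) {(x, h). has_age tie h n x i}"

definition tail :: "(nat \<Rightarrow> real) \<Rightarrow> nat \<Rightarrow> real" where
  "tail a i = (\<Sum>j. a (i + j))"

end

theory Submission
  imports Defs
begin

text \<open>
  Let \<open>P\<^sub>i\<close> be the number of probes of age at least \<open>i\<close> and \<open>A\<^sub>i\<close> the set of slots hit by them.  Ages in
  a slot never decrease, so \<open>A\<^sub>i\<close> is the set of slots whose final occupant has age at least \<open>i\<close>; each
  such occupant made exactly one \<open>i\<close>-th probe, hence \<open>P\<^sub>i - P\<^sub>i\<^sub>+\<^sub>1 = |A\<^sub>i|\<close>.  Every probe is fresh, so the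
  probes of age at least \<open>i\<close> form a coupon collector process, and a second moment bound for the
  martingale \<open>P\<^sub>i - (\<Sum>s<|A\<^sub>i|. m / (m - s))\<close> gives \<open>|A\<^sub>i| \<approx> m (1 - exp (- P\<^sub>i / m))\<close>.  Thus \<open>P\<^sub>i / m\<close>
  converges to a limit satisfying the recurrence, started from \<open>|A\<^sub>1| = n\<close>, and this limit
  is the double tail of \<open>q\<close>.
\<close>

section \<open>Uniform lists and independent probes\<close>

lemma space_probe_space [simp]: "space (probe_space m) = UNIV"
  by (simp add: probe_space_def space_PiM PiE_UNIV_domain)

lemma prob_space_probe_space: "prob_space (probe_space m)"
  unfolding probe_space_def by (intro prob_space_PiM prob_space_measure_pmf)

lemma measure_cylinder:
  fixes f :: "nat \<times> nat \<Rightarrow> nat"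
  assumes "finite J" "\<And>d. d \<in> J \<Longrightarrow> f d < m"
  shows "measure (probe_space m) {h. \<forall>d\<in>J. h d = f d} = (1 / real m) ^ card J"
\<comment> \<open>For empty \<open>J\<close> the number \<open>m\<close> may be 0; any element of
  \<open>J\<close> forces \<open>{..<m}\<close> to be nonempty.\<close>
proof (cases "J = {}")
  case True
  then show ?thesis
    using prob_space.prob_space[OF prob_space_probe_space[of m]] by simp
next
  case False
  then have m: "{..<m} \<noteq> {}" using assms(2) by fastforce
  interpret product_prob_space "\<lambda>_. measure_pmf (pmf_of_set {..<m})" "UNIV :: (nat \<times> nat) set" ..
  have "prod_emb UNIV (\<lambda>_. measure_pmf (pmf_of_set {..<m})) J (Pi\<^sub>E J (\<lambda>d. {f d})) = {h. \<forall>d\<in>J. h d = f d}"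
    by (auto simp: prod_emb_def space_PiM PiE_UNIV_domain PiE_iff restrict_def)
  moreover have "measure (measure_pmf (pmf_of_set {..<m})) {f d} = 1 / real m" if "d \<in> J" for d
    using m assms(2)[OF that] by (simp add: measure_pmf_single pmf_of_set)
  ultimately show ?thesis
    using measure_PiM_emb[of J "\<lambda>d. {f d}"] assms(1)
    by (simp add: probe_space_def)
qed

lemma measurable_coordinate [measurable]:
  "(\<lambda>h. h d) \<in> measurable (probe_space m) (count_space UNIV)"
proof -
  have "(\<lambda>h. h d) \<in> measurable (probe_space m) (measure_pmf (pmf_of_set {..<m}))"
    unfolding probe_space_def by measurable
  then show ?thesis by simp
qed

text \<open>Expectation over a uniform list of \<open>t\<close> draws from \<open>m\<close> slots.
  As a finite sum it keeps the martingale estimates free of integrability conditions.\<close>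

definition avg :: "nat \<Rightarrow> nat \<Rightarrow> (nat list \<Rightarrow> real) \<Rightarrow> real" where
  "avg m t f = (\<Sum>xs | set xs \<subseteq> {..<m} \<and> length xs = t. f xs) / real m ^ t"

lemma avg_0 [simp]: "avg m 0 f = f []"
proof -
  have "{xs. set xs \<subseteq> {..<m} \<and> length xs = 0} = {[]}" by auto
  then show ?thesis by (simp add: avg_def)
qed

text \<open>The latest draw is the head of the list, so the inner mean is the conditional
  expectation given the past. All martingale computations start from this form.\<close>

lemma avg_Suc: "avg m (Suc t) f = avg m t (\<lambda>xs. (\<Sum>s<m. f (s # xs)) / real m)"
proof -
  let ?L = "{xs. set xs \<subseteq> {..<m} \<and> length xs = t}"
  have "(\<Sum>xs | set xs \<subseteq> {..<m} \<and> length xs = Suc t. f xs) = (\<Sum>(xs, s)\<in>?L \<times> {..<m}. f (s # xs))"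
    unfolding lists_length_Suc_eq
    by (subst sum.reindex) (auto simp: inj_on_def intro!: sum.cong)
  also have "\<dots> = (\<Sum>xs\<in>?L. \<Sum>s<m. f (s # xs))"
    by (rule sum.cartesian_product[symmetric])
  finally show ?thesis
    by (simp add: avg_def sum_divide_distrib ac_simps)
qed

lemma finite_lists [simp]: "finite {xs. set xs \<subseteq> {..<m::nat} \<and> length xs = t}"
  by (rule finite_lists_length_eq) simp

lemma avg_add: "avg m t (\<lambda>xs. f xs + g xs) = avg m t f + avg m t g"
  by (simp add: avg_def sum.distrib add_divide_distrib)

lemma avg_diff: "avg m t (\<lambda>xs. f xs - g xs) = avg m t f - avg m t g"
  by (simp add: avg_def sum_subtractf diff_divide_distrib)

lemma avg_cmult: "avg m t (\<lambda>xs. c * f xs) = c * avg m t f"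
  by (simp add: avg_def flip: sum_distrib_left)

lemma avg_const: "0 < m \<Longrightarrow> avg m t (\<lambda>xs. c) = c"
  by (simp add: avg_def card_lists_length_eq)

lemma avg_mono:
  assumes "\<And>xs. set xs \<subseteq> {..<m} \<Longrightarrow> length xs = t \<Longrightarrow> f xs \<le> g xs"
  shows "avg m t f \<le> avg m t g"
  unfolding avg_def by (intro divide_right_mono sum_mono) (auto simp: assms)

lemma avg_nonneg: "(\<And>xs. 0 \<le> f xs) \<Longrightarrow> 0 \<le> avg m t f"
  unfolding avg_def by (intro divide_nonneg_nonneg sum_nonneg) auto

lemma avg_cong:
  assumes "\<And>xs. set xs \<subseteq> {..<m} \<Longrightarrow> length xs = t \<Longrightarrow> f xs = g xs"
  shows "avg m t f = avg m t g"
  by (intro antisym avg_mono) (simp_all add: assms)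

lemma avg_sum: "avg m t (\<lambda>xs. \<Sum>i\<in>I. f i xs) = (\<Sum>i\<in>I. avg m t (f i))"
  unfolding avg_def by (subst sum.swap) (simp add: sum_divide_distrib)

lemma abs_avg_le: "\<bar>avg m t f\<bar> \<le> avg m t (\<lambda>xs. \<bar>f xs\<bar>)"
  unfolding avg_def by (simp add: abs_divide divide_right_mono)

section \<open>The insertion process as a state machine\<close>

text \<open>Serves to average over the slot of the next probe when only its membership in a set of
  occupied slots matters.\<close>

lemma sum_if_mem:
  fixes u v :: real
  assumes "A \<subseteq> {..<m}"
  shows "(\<Sum>s<m. if s \<in> A then u else v) = real (card A) * u + (real m - real (card A)) * v"
proof -
  have "(\<Sum>s<m. if s \<in> A then u else v) = (\<Sum>s\<in>A. u) + (\<Sum>s\<in>{..<m} - A. v)"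
    using assms by (subst sum.If_cases) (auto simp: Int_absorb1 Diff_eq[symmetric] Collect_mem_eq)
  then show ?thesis
    using assms card_mono[of "{..<m}" A] by (simp add: card_Diff_subset finite_subset of_nat_diff)
qed

lemma exp_lipschitz: "0 \<le> x \<Longrightarrow> 0 \<le> y \<Longrightarrow> \<bar>exp (- x) - exp (- y)\<bar> \<le> \<bar>x - y :: real\<bar>"
proof (induction x y rule: linorder_wlog)
  case (le x y)
  have "exp (- x) - exp (- y) = exp (- x) * (1 - exp (- (y - x)))"
    by (simp add: algebra_simps flip: exp_add)
  also have "\<dots> \<le> 1 * (y - x)"
  proof (rule mult_mono)
    show "1 - exp (- (y - x)) \<le> y - x"
      using exp_ge_add_one_self[of "- (y - x)"] by linarith
  qed (use le in auto)
  finally show ?case using le by simp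
qed (simp add: abs_minus_commute)

text \<open>
  In \<open>State T k x j\<close> the keys below \<open>k\<close> have been inserted, and key \<open>x\<close>, which is \<open>k\<close> or a key evicted
  during the insertion of \<open>k\<close>, is about to make its \<open>j\<close>-th probe.
\<close>

datatype state = State (tbl: table) (placed: nat) (key: nat) (age: nat)

definition older :: "nat \<Rightarrow> table \<Rightarrow> nat set" where
  "older i T = {s. \<exists>y l. T s = Some (y, l) \<and> i \<le> l}"

locale robin_hood =
  fixes tie :: "nat \<Rightarrow> nat \<Rightarrow> bool" and n m :: nat
  assumes n_less_m: "n < m"
begin

text \<open>Freezing the state once \<open>n\<close> keys are placed allows histories of one fixed
  length, whatever the true number of probes is.\<close>

definition step :: "nat \<Rightarrow> state \<Rightarrow> state" where
  "step s S =
    (if n \<le> placed S then S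
     else case tbl S s of
       None \<Rightarrow> State ((tbl S)(s \<mapsto> (key S, age S))) (Suc (placed S)) (Suc (placed S)) 1
     | Some (y, l) \<Rightarrow>
         if evicts tie (key S, age S) (y, l)
         then State ((tbl S)(s \<mapsto> (key S, age S))) (placed S) y (Suc l)
         else State (tbl S) (placed S) (key S) (Suc (age S)))"

text \<open>The state is driven by the list of slots probed so far, most recent first.\<close>

primrec run :: "nat list \<Rightarrow> state" where
  "run [] = State Map.empty 0 0 1"
| "run (s # xs) = step s (run xs)"

text \<open>
  After termination the probes of the unused key \<open>n\<close> serve as dummies, so that the history goes on.
\<close>

definition next_probe :: "nat list \<Rightarrow> nat \<times> nat" where
  "next_probe xs =
    (if placed (run xs) < n then (key (run xs), age (run xs)) else (n, length xs))"

primrec history :: "(nat \<times> nat \<Rightarrow> nat) \<Rightarrow> nat \<Rightarrow> nat list" where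
  "history h 0 = []"
| "history h (Suc t) = h (next_probe (history h t)) # history h t"

primrec queries :: "nat list \<Rightarrow> (nat \<times> nat) list" where
  "queries [] = []"
| "queries (s # xs) = next_probe xs # queries xs"

definition active :: "nat \<Rightarrow> nat list \<Rightarrow> bool" where
  "active i xs \<longleftrightarrow> placed (run xs) < n \<and> i \<le> age (run xs)"

text \<open>This is \<open>P\<^sub>i\<close> of the overview, stopped after \<open>length xs\<close>
  steps. Dummy probes are never \<open>active\<close>, hence not counted.\<close>

primrec probes :: "nat \<Rightarrow> nat list \<Rightarrow> nat" where
  "probes i [] = 0"
| "probes i (s # xs) = probes i xs + of_bool (active i xs)"

abbreviation occ :: "nat \<Rightarrow> nat list \<Rightarrow> nat set" where
  "occ i xs \<equiv> older i (tbl (run xs))"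

text \<open>A key has at most one location: a single slot, or in hand as \<open>key S\<close>. At
  the end the dummy key \<open>n\<close> is in hand, so that all stored keys are below
  \<open>n\<close>.\<close>

definition valid :: "state \<Rightarrow> bool" where
  "valid S \<longleftrightarrow> placed S \<le> n \<and> key S \<le> placed S \<and> (placed S = n \<longrightarrow> key S = n \<and> age S = 1) \<and>
     1 \<le> age S \<and>
     (\<forall>s y l. tbl S s = Some (y, l) \<longrightarrow> 1 \<le> l \<and> y \<le> placed S \<and> y \<noteq> key S) \<and>
     (\<forall>s s' y l l'. tbl S s = Some (y, l) \<longrightarrow> tbl S s' = Some (y, l') \<longrightarrow> s = s')"

lemma valid_step:
  assumes "valid S"
  shows "valid (step s S)"
proof (cases "n \<le> placed S")
  case True
  then show ?thesis using assms by (simp add: step_def)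
next
  case False
  show ?thesis
  proof (cases "tbl S s")
    case None
    have "y \<le> placed S" if "tbl S r = Some (y, l)" for r y l
      using assms that by (auto simp: valid_def)
    moreover have "y \<noteq> key S" if "tbl S r = Some (y, l)" for r y l
      using assms that by (auto simp: valid_def)
    ultimately show ?thesis
      using None False assms unfolding valid_def step_def
      by (auto split: if_splits) (metis Suc_n_not_le_n le_SucI)+
  next
    case (Some a)
    obtain y l where a: "a = (y, l)" by fastforce
    have "y \<le> placed S" "y \<noteq> key S"
      using assms Some a by (auto simp: valid_def)
    moreover have "s' = s" if "tbl S s' = Some (y, l')" for s' l'
      using assms Some a that unfolding valid_def by blast
    ultimately show ?thesis
      using Some False assms a unfolding valid_def step_def
      by (auto split: if_splits)
  qed
qed

lemma valid_run: "valid (run xs)"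
  by (induction xs) (auto simp: valid_step, auto simp: valid_def)

section \<open>Occupied slots and probe counts by age\<close>

lemma dom_run: "dom (tbl (run xs)) \<subseteq> set xs"
proof (induction xs)
  case (Cons s xs)
  then have "tbl (run xs) r = None" if "r \<notin> set xs" for r
    using that by blast
  then show ?case by (auto simp: step_def split: if_splits option.splits)
qed simp

lemma occ_subset: "occ i xs \<subseteq> set xs"
  using dom_run[of xs] by (auto simp: older_def)

lemma finite_occ [simp]: "finite (occ i xs)"
  using occ_subset finite_subset by blast

text \<open>A probe of age at least \<open>i\<close> either takes the slot or loses to a resident at
  least as old, and an eviction never lowers the age found in a slot. Both hold for every rule
  \<open>tie\<close>, so \<open>occ i\<close> collects exactly the slots hit by probes of age at
  least \<open>i\<close>.\<close>

lemma occ_Cons: "occ i (s # xs) = (if active i xs then insert s (occ i xs) else occ i xs)"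
  by (auto simp: older_def step_def active_def evicts_def split: option.splits if_splits)

lemma card_occ_Cons:
  "card (occ i (s # xs)) = card (occ i xs) + of_bool (active i xs \<and> s \<notin> occ i xs)"
  unfolding occ_Cons by (simp add: insert_absorb)

lemma occ_one: "occ 1 xs = dom (tbl (run xs))"
  using valid_run[of xs] by (fastforce simp: older_def valid_def)

lemma card_occ_one: "card (occ 1 xs) = placed (run xs)"
proof (induction xs)
  case Nil
  then show ?case by (simp add: older_def)
next
  case (Cons s xs)
  have "1 \<le> age (run xs)" using valid_run[of xs] by (simp add: valid_def)
  then have "active 1 xs \<longleftrightarrow> placed (run xs) < n" by (simp add: active_def)
  moreover have "s \<in> occ 1 xs \<longleftrightarrow> tbl (run xs) s \<noteq> None"
    unfolding occ_one by auto
  ultimately show ?case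
    unfolding card_occ_Cons Cons.IH by (auto simp: step_def split: option.splits)
qed

lemma card_occ_le: "1 \<le> i \<Longrightarrow> card (occ i xs) \<le> placed (run xs)"
  unfolding card_occ_one[symmetric]
  by (rule card_mono[OF finite_occ]) (auto simp: older_def intro: le_trans)

lemma placed_le: "placed (run xs) \<le> n"
  using valid_run[of xs] by (simp add: valid_def)

text \<open>The ages of a key increase by one from probe to probe, so the probes of age exactly
  \<open>i\<close> correspond to the keys that have made their \<open>i\<close>-th probe. These are
  the residents of age at least \<open>i\<close> and possibly the key in hand, whose pending probe
  must then have an age above \<open>i\<close>.\<close>

lemma probes_eq:
  assumes "1 \<le> i"
  shows "probes i xs = probes (Suc i) xs + card (occ i xs) + of_bool (i < age (run xs))"
proof (induction xs)
  case Nil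
  then show ?case using assms by (simp add: older_def)
next
  case (Cons s xs)
  have o: "s \<in> occ i xs \<longleftrightarrow> (\<exists>y l. tbl (run xs) s = Some (y, l) \<and> i \<le> l)"
    by (auto simp: older_def)
  have "of_bool (active i xs) + of_bool (i < age (run xs)) =
      of_bool (active (Suc i) xs) + of_bool (active i xs \<and> s \<notin> occ i xs)
      + (of_bool (i < age (step s (run xs))) :: nat)"
    unfolding o using assms
    by (auto simp: active_def step_def evicts_def split: option.splits if_splits)
  then show ?case unfolding card_occ_Cons using Cons.IH by simp
qed

text \<open>The age of a key only grows, whether the key is stored or in hand, so no pair of key and
  age is consulted twice. This invariant records how far each key has got; the last disjunct
  concerns the dummies, which are numbered by the length of the history.\<close>

lemma queries_seen:
  "(y, l) \<in> set (queries xs) \<Longrightarrow>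
    (\<exists>s k. tbl (run xs) s = Some (y, k) \<and> l \<le> k) \<or>
    placed (run xs) < n \<and> y = key (run xs) \<and> l < age (run xs) \<or>
    placed (run xs) = n \<and> y = n \<and> l < length xs"
proof (induction xs arbitrary: y l)
  case Nil
  then show ?case by simp
next
  case (Cons s xs)
  note v = valid_run[of xs]
  show ?case
  proof (cases "placed (run xs) < n")
    case False
    then show ?thesis using Cons.IH[of y l] Cons.prems v
      by (auto simp: next_probe_def step_def valid_def)
  next
    case True
    let ?T = "tbl (run xs)" and ?x = "key (run xs)" and ?j = "age (run xs)"
    have disj: "(\<exists>s k. ?T s = Some (y, k) \<and> l \<le> k) \<or> y = ?x \<and> l \<le> ?j"
      using Cons.IH[of y l] Cons.prems True by (auto simp: next_probe_def)
    show ?thesis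
    proof (cases "?T s")
      case None
      from disj show ?thesis
      proof
        assume "\<exists>s k. ?T s = Some (y, k) \<and> l \<le> k"
        then obtain r k' where "?T r = Some (y, k')" "l \<le> k'" by blast
        moreover from this None have "r \<noteq> s" by auto
        ultimately have "tbl (run (s # xs)) r = Some (y, k')"
          using True None by (simp add: step_def)
        then show ?thesis using \<open>l \<le> k'\<close> by blast
      qed (use None True in \<open>auto simp: step_def\<close>)
    next
      case (Some a)
      obtain z k where a: "a = (z, k)" by fastforce
      show ?thesis
      proof (cases "evicts tie (?x, ?j) (z, k)")
        case ev: True
        from disj show ?thesis
        proof
          assume "\<exists>s k. ?T s = Some (y, k) \<and> l \<le> k"
          then obtain r k' where "?T r = Some (y, k')" "l \<le> k'" by blast
          then show ?thesis using Some a ev True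
            by (cases "r = s") (auto simp: step_def)
        qed (use Some a ev True in \<open>auto simp: step_def\<close>)
      next
        case False
        then show ?thesis using disj Some a True by (auto simp: step_def)
      qed
    qed
  qed
qed

lemma next_probe_fresh: "next_probe xs \<notin> set (queries xs)"
proof
  assume *: "next_probe xs \<in> set (queries xs)"
  obtain y l where yl: "next_probe xs = (y, l)" by fastforce
  show False
    using queries_seen[of y l xs] * yl valid_run[of xs]
    by (auto simp: next_probe_def valid_def split: if_splits)
qed

lemma distinct_queries: "distinct (queries xs)"
  by (induction xs) (auto simp: next_probe_fresh)

lemma length_queries [simp]: "length (queries xs) = length xs"
  by (induction xs) auto

text \<open>Along a fixed \<open>xs\<close> the coordinates to be read depend on \<open>xs\<close>
  alone. This turns an event about an adaptive process into a cylinder event.\<close>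

lemma history_eq_iff: "history h (length xs) = xs \<longleftrightarrow> map h (queries xs) = xs"
  by (induction xs) auto

lemma length_history [simp]: "length (history h t) = t"
  by (induction t) auto

text \<open>Each machine step unfolds one recursive call, so the pending call of
  \<open>rh_probe\<close> keeps its value throughout an insertion. The equation is one between
  options and covers insertions that never end.\<close>

lemma rh_table_history:
  "if placed (run (history h t)) < n
   then rh_table tie h (Suc (placed (run (history h t)))) =
     rh_probe tie h (tbl (run (history h t))) (key (run (history h t))) (age (run (history h t)))
   else rh_table tie h n = Some (tbl (run (history h t)))"
proof (induction t)
  case 0
  have start: "run (history h 0) = State Map.empty 0 0 1" by simp
  show ?case unfolding start by (cases "n = 0") auto
next
  case (Suc t)
  let ?S = "run (history h t)"
  show ?case
  proof (cases "placed ?S < n")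
    case False
    then show ?thesis using Suc by (simp add: step_def)
  next
    case True
    then have eq: "rh_table tie h (Suc (placed ?S)) = rh_probe tie h (tbl ?S) (key ?S) (age ?S)"
      using Suc by simp
    let ?s = "h (key ?S, age ?S)"
    have np: "next_probe (history h t) = (key ?S, age ?S)"
      using True by (simp add: next_probe_def)
    have ne: "rh_table tie h n = rh_table tie h (Suc (placed ?S))" if "\<not> Suc (placed ?S) < n"
      using that True by (metis Suc_lessI)
    show ?thesis
    proof (cases "tbl ?S ?s")
      case None
      then have "rh_table tie h (Suc (placed ?S)) = Some ((tbl ?S)(?s \<mapsto> (key ?S, age ?S)))"
        using eq by (subst (asm) rh_probe.simps) simp
      then show ?thesis using None True ne np by (auto simp: step_def fun_upd_def)
    next
      case (Some a)
      obtain z k where a: "a = (z, k)" by fastforce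
      show ?thesis
        using eq Some a True np by (subst (asm) rh_probe.simps) (auto simp: step_def fun_upd_def)
    qed
  qed
qed

section \<open>Agreement with the given insertion algorithm\<close>

text \<open>A defined value rests on finitely many recursive calls, and each of them is one step of
  the machine.\<close>

lemma rh_probe_terminates:
  assumes "rh_probe tie h T x j = Some T'" "run (history h t) = State T k x j" "k < n"
  shows "\<exists>t'. placed (run (history h t')) = Suc k"
proof -
  \<comment> \<open>\<open>partial_function\<close> varies the parameters \<open>tie\<close> and \<open>h\<close> in its induction rule, hence the equations.\<close>
  have "tie = tie \<longrightarrow> h = h \<longrightarrow> (\<forall>t. run (history h t) = State T k x j \<longrightarrow>
    (\<exists>t'. placed (run (history h t')) = Suc k))"
  proof (rule rh_probe.raw_induct[where xa = "((((tie, h), T), x), j)" and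
        P = "\<lambda>tie' h' T x j _. tie' = tie \<longrightarrow> h' = h \<longrightarrow>
          (\<forall>t. run (history h t) = State T k x j \<longrightarrow> (\<exists>t'. placed (run (history h t')) = Suc k))",
        unfolded prod.case])
    show "rh_probe tie h T x j = Some T'" by fact
  next
    fix f tie' h' T x j r
    assume IH: "\<And>tie' h' T x j r. f tie' h' T x j = Some r \<Longrightarrow>
        tie' = tie \<longrightarrow> h' = h \<longrightarrow>
        (\<forall>t. run (history h t) = State T k x j \<longrightarrow> (\<exists>t'. placed (run (history h t')) = Suc k))"
      and eq: "(case T (h' (x, j)) of
          None \<Rightarrow> Some (T(h' (x, j) \<mapsto> (x, j)))
        | Some (y, l) \<Rightarrow>
            if evicts tie' (x, j) (y, l)
            then f tie' h' (T(h' (x, j) \<mapsto> (x, j))) y (Suc l)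
            else f tie' h' T x (Suc j)) = Some r"
    show "tie' = tie \<longrightarrow> h' = h \<longrightarrow>
        (\<forall>t. run (history h t) = State T k x j \<longrightarrow> (\<exists>t'. placed (run (history h t')) = Suc k))"
    proof (intro impI allI)
      fix t assume eqs: "tie' = tie" "h' = h" and t: "run (history h t) = State T k x j"
      have S: "run (history h (Suc t)) = step (h (x, j)) (State T k x j)"
        using t \<open>k < n\<close> by (simp add: next_probe_def)
      show "\<exists>t'. placed (run (history h t')) = Suc k"
      proof (cases "T (h (x, j))")
        case None
        then show ?thesis using S \<open>k < n\<close>
          by (intro exI[of _ "Suc t"]) (simp add: step_def)
      next
        case (Some a)
        obtain y l where a: "a = (y, l)" by fastforce
        show ?thesis
        proof (cases "evicts tie (x, j) (y, l)")
          case True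
          then have "f tie h (T(h (x, j) \<mapsto> (x, j))) y (Suc l) = Some r"
            using eq eqs Some a by simp
          moreover have "run (history h (Suc t)) = State (T(h (x, j) \<mapsto> (x, j))) k y (Suc l)"
            using S Some a True \<open>k < n\<close> by (simp add: step_def)
          ultimately show ?thesis using IH by blast
        next
          case False
          then have "f tie h T x (Suc j) = Some r"
            using eq eqs Some a by simp
          moreover have "run (history h (Suc t)) = State T k x (Suc j)"
            using S Some a False \<open>k < n\<close> by (simp add: step_def)
          ultimately show ?thesis using IH by blast
        qed
      qed
    qed
  qed
  then show ?thesis using assms by blast
qed

lemma rh_table_terminates:
  assumes "rh_table tie h n = Some T"
  shows "\<exists>t. placed (run (history h t)) = n"
proof -
  \<comment> \<open>\<open>Option.bind\<close> propagates \<open>None\<close>, so definedness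
    descends from \<open>n\<close> to all smaller \<open>k\<close>.\<close>
  have *: "rh_table tie h k \<noteq> None" if "k \<le> n" for k
    using that by (rule inc_induct) (use assms in \<open>auto simp: bind_eq_Some_conv\<close>)
  have "\<exists>t. placed (run (history h t)) = k" if "k \<le> n" for k
    using that
  proof (induction k)
    case 0
    show ?case by (rule exI[of _ 0]) simp
  next
    case (Suc k)
    then obtain t where t: "placed (run (history h t)) = k" by auto
    let ?S = "run (history h t)"
    have "rh_table tie h (Suc k) = rh_probe tie h (tbl ?S) (key ?S) (age ?S)"
      using rh_table_history[of h t] t Suc.prems by simp
    then obtain T' where "rh_probe tie h (tbl ?S) (key ?S) (age ?S) = Some T'"
      using *[OF Suc.prems] by auto
    then show ?case
      using Suc.prems t by (intro rh_probe_terminates[of h "tbl ?S" "key ?S" "age ?S" T' t k]) (auto simp: state.expand)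
  qed
  then show ?thesis by blast
qed

text \<open>Here \<open>h\<close> enters only through its finite histories, and only countably many
  of them, which makes the event measurable.\<close>

lemma has_age_iff:
  "has_age tie h n x i \<longleftrightarrow>
    (\<exists>t. placed (run (history h t)) = n \<and> (\<exists>s. tbl (run (history h t)) s = Some (x, i)))"
proof
  assume "has_age tie h n x i"
  then obtain T s where T: "rh_table tie h n = Some T" "T s = Some (x, i)"
    by (auto simp: has_age_def)
  obtain t where t: "placed (run (history h t)) = n" using rh_table_terminates[OF T(1)] by blast
  then show "\<exists>t. placed (run (history h t)) = n \<and> (\<exists>s. tbl (run (history h t)) s = Some (x, i))"
    using rh_table_history[of h t] T by auto
next
  assume "\<exists>t. placed (run (history h t)) = n \<and> (\<exists>s. tbl (run (history h t)) s = Some (x, i))"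
  then show "has_age tie h n x i"
    using rh_table_history[of h] unfolding has_age_def by (metis less_irrefl)
qed

lemma has_age_iff_at:
  assumes "placed (run (history h t)) = n"
  shows "has_age tie h n x i \<longleftrightarrow> (\<exists>s. tbl (run (history h t)) s = Some (x, i))"
  using rh_table_history[of h t] assms unfolding has_age_def by auto

text \<open>The coordinate read next is random, but the earlier history takes only countably many
  values; on each of them the coordinate is fixed.\<close>

lemma measurable_history [measurable]:
  "(\<lambda>h. history h t) \<in> measurable (probe_space m) (count_space UNIV)"
proof (induction t)
  case 0
  show ?case by simp
next
  case (Suc t)
  have "(\<lambda>h. (h d # xs)) \<in> measurable (probe_space m) (count_space UNIV)" for d and xs :: "nat list"
    by measurable
  then show ?case
    unfolding history.simps
    by (intro measurable_compose_countable[where f = "\<lambda>xs h. h (next_probe xs) # xs", OF _ Suc])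
qed

lemma measurable_has_age [measurable]:
  "Measurable.pred (probe_space m) (\<lambda>h. has_age tie h n x i)"
  unfolding has_age_iff by measurable

section \<open>Deferred decisions\<close>

lemma prob_history_eq:
  assumes "set xs \<subseteq> {..<m}"
  shows "measure (probe_space m) {h. history h (length xs) = xs} = (1 / real m) ^ length xs"
proof -
  \<comment> \<open>\<open>f\<close> sends each query to the answer recorded for it in
    \<open>xs\<close>; distinctness of the queries rules out conflicting answers.\<close>
  define f where "f = the \<circ> map_of (zip (queries xs) xs)"
  have nth: "f (queries xs ! i) = xs ! i" if "i < length xs" for i
    using that distinct_queries[of xs]
    by (simp add: f_def map_of_zip_nth)
  have eq: "{h. history h (length xs) = xs} = {h. \<forall>d\<in>set (queries xs). h d = f d}"
    unfolding history_eq_iff using nth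
    by (auto simp: list_eq_iff_nth_eq all_set_conv_all_nth)
  have lt: "f d < m" if "d \<in> set (queries xs)" for d
  proof -
    obtain i where "i < length xs" "d = queries xs ! i"
      using \<open>d \<in> set (queries xs)\<close> by (auto simp: in_set_conv_nth)
    then show ?thesis using nth[of i] assms nth_mem[of i xs] by (metis lessThan_iff subsetD)
  qed
  show ?thesis
    unfolding eq by (subst measure_cylinder) (use lt in \<open>auto simp: distinct_card[OF distinct_queries]\<close>)
qed

lemma events_history: "{h. Q (history h t)} \<in> sets (probe_space m)"
  using measurable_sets[OF measurable_history[of t], of "Collect Q"] by (simp add: vimage_def)

text \<open>As no probe is ever consulted twice, the history is a uniform list.\<close>

lemma prob_history:
  "measure (probe_space m) {h. P (history h t)} = avg m t (\<lambda>xs. of_bool (P xs))"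
proof -
  interpret prob_space "probe_space m" by (rule prob_space_probe_space)
  let ?L = "{xs. set xs \<subseteq> {..<m} \<and> length xs = t}"
  have sum: "prob {h. history h t \<in> ?L \<and> Q (history h t)} = avg m t (\<lambda>xs. of_bool (Q xs))" for Q
  proof -
    have "{h. history h t \<in> ?L \<and> Q (history h t)} = (\<Union>xs\<in>{xs\<in>?L. Q xs}. {h. history h t = xs})"
      by auto
    also have "prob \<dots> = (\<Sum>xs\<in>{xs\<in>?L. Q xs}. prob {h. history h t = xs})"
    proof (rule finite_measure_finite_Union)
      show "finite {xs\<in>?L. Q xs}" by (rule finite_subset[OF _ finite_lists[of m t]]) auto
    qed (use events_history[of "\<lambda>ys. ys = _" t] in \<open>auto simp: disjoint_family_on_def\<close>)
    also have "\<dots> = (\<Sum>xs\<in>{xs\<in>?L. Q xs}. 1 / real m ^ t)"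
      using prob_history_eq by (intro sum.cong) (auto simp: power_divide)
    also have "\<dots> = (\<Sum>xs\<in>?L. of_bool (Q xs) / real m ^ t)"
      by (rule sum.mono_neutral_cong_left) auto
    finally show ?thesis unfolding avg_def sum_divide_distrib .
  qed
  \<comment> \<open>A history may leave \<open>{..<m}\<close>, but only on a null set: the trivial
    predicate in \<open>sum\<close> shows that \<open>?L\<close> carries the full mass.\<close>
  have "prob {h. history h t \<in> ?L} = 1"
    using sum[of "\<lambda>_. True"] avg_const[of m t 1] n_less_m by simp
  then have "AE h in probe_space m. history h t \<in> ?L"
    using AE_prob_1[of "{h. history h t \<in> ?L}"] by simp
  then have "prob {h. P (history h t)} = prob {h. history h t \<in> ?L \<and> P (history h t)}"
    using events_history[of P t] events_history[of "\<lambda>xs. xs \<in> ?L \<and> P xs" t]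
    by (intro finite_measure_eq_AE) auto
  then show ?thesis using sum by simp
qed

text \<open>If all keys are placed by time \<open>t\<close>, the final table can be read off the
  history. The two events therefore differ only on unfinished histories.\<close>

lemma prob_has_age:
  "\<bar>measure (probe_space m) {h. has_age tie h n x i}
     - avg m t (\<lambda>xs. of_bool (\<exists>s. tbl (run xs) s = Some (x, i)))\<bar>
    \<le> avg m t (\<lambda>xs. of_bool (placed (run xs) < n))"
proof -
  interpret prob_space "probe_space m" by (rule prob_space_probe_space)
  define A where "A = {h. has_age tie h n x i}"
  define B where "B = {h. \<exists>s. tbl (run (history h t)) s = Some (x, i)}"
  define D where "D = {h. placed (run (history h t)) < n}"
  have ev: "A \<in> events" "B \<in> events" "D \<in> events"
    using measurable_has_age[of x i] events_history[of _ t]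
    unfolding A_def B_def D_def pred_def by simp_all
  have "A \<subseteq> B \<union> D" "B \<subseteq> A \<union> D"
    using placed_le has_age_iff_at[of _ t x i]
    unfolding A_def B_def D_def by (auto simp: order_less_le)
  then have "prob A \<le> prob (B \<union> D)" "prob B \<le> prob (A \<union> D)"
    using ev by (auto intro!: finite_measure_mono)
  moreover have "prob (B \<union> D) \<le> prob B + prob D" "prob (A \<union> D) \<le> prob A + prob D"
    using ev by (auto intro!: measure_Un_le)
  moreover have "prob B = avg m t (\<lambda>xs. of_bool (\<exists>s. tbl (run xs) s = Some (x, i)))"
    unfolding B_def by (rule prob_history)
  moreover have "prob D = avg m t (\<lambda>xs. of_bool (placed (run xs) < n))"
    unfolding D_def by (rule prob_history)
  ultimately show ?thesis unfolding A_def by simp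
qed

lemma age_prob_eq:
  assumes "0 < n"
  shows "age_prob tie n m i = (\<Sum>x<n. measure (probe_space m) {h. has_age tie h n x i}) / real n"
proof -
  interpret prob_space "probe_space m" by (rule prob_space_probe_space)
  let ?P = "measure_pmf (pmf_of_set {..<n})"
  let ?X = "{(x, h). has_age tie h n x i}"
  have "(\<lambda>(x, h). has_age tie h n x i) \<in> measurable (count_space UNIV \<Otimes>\<^sub>M probe_space m) (count_space UNIV)"
    by (rule measurable_pair_measure_countable1) auto
  then have "Measurable.pred (?P \<Otimes>\<^sub>M probe_space m) (\<lambda>(x, h). has_age tie h n x i)"
    using measurable_cong_sets[OF sets_pair_measure_cong[of ?P "count_space UNIV" "probe_space m"] refl]
    by auto
  then have X: "?X \<in> sets (?P \<Otimes>\<^sub>M probe_space m)"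
    by (simp add: pred_def space_pair_measure)
  have "emeasure (?P \<Otimes>\<^sub>M probe_space m) ?X = (\<integral>\<^sup>+x. ennreal (prob {h. has_age tie h n x i}) \<partial>?P)"
    using emeasure_pair_measure_alt[OF X] by (simp add: vimage_def emeasure_eq_measure)
  also have "\<dots> = ennreal (\<integral>x. prob {h. has_age tie h n x i} \<partial>?P)"
    by (intro nn_integral_eq_integral measure_pmf.integrable_const_bound[where B = 1]) auto
  also have "(\<integral>x. prob {h. has_age tie h n x i} \<partial>?P) = (\<Sum>x<n. prob {h. has_age tie h n x i}) / real n"
    using assms by (subst integral_pmf_of_set) auto
  finally show ?thesis
    by (simp add: age_prob_def measure_def sum_nonneg)
qed

section \<open>The coupon collector martingale\<close>

text \<open>Expected number of uniform draws until \<open>a\<close> of the \<open>m\<close> slots have been hit.\<close>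

definition cost :: "nat \<Rightarrow> real" where
  "cost a = (\<Sum>s<a. real m / (real m - real s))"

definition dev :: "nat \<Rightarrow> nat list \<Rightarrow> real" where
  "dev i xs = real (probes i xs) - cost (card (occ i xs))"

text \<open>Bounds every summand of \<open>cost a\<close> for \<open>a \<le> n\<close>: the mean
  waiting time for a free slot when \<open>n\<close> slots are taken.\<close>

definition wait_bound :: real where
  "wait_bound = real m / (real m - real n)"

definition unfinished :: "nat \<Rightarrow> real" where
  "unfinished t = avg m t (\<lambda>xs. of_bool (placed (run xs) < n))"

lemma m_pos: "0 < m"
  using n_less_m by simp

lemma wait_bound_ge_1: "1 \<le> wait_bound"
  using n_less_m by (simp add: wait_bound_def)

lemma dev_Cons:
  "dev i (s # xs) =
    (if \<not> active i xs then dev i xs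
     else if s \<in> occ i xs then dev i xs + 1
     else dev i xs + 1 - real m / (real m - real (card (occ i xs))))"
  unfolding dev_def card_occ_Cons by (simp add: cost_def)

lemma occ_less:
  assumes "active i xs" "1 \<le> i"
  shows "card (occ i xs) < n"
  using card_occ_le[of i xs] assms by (simp add: active_def)

text \<open>With \<open>a\<close> slots already hit, an active probe adds 1 and, with conditional
  probability \<open>(m - a) / m\<close>, also subtracts \<open>m / (m - a)\<close>. The mean
  increment is 0.\<close>

lemma avg_dev:
  assumes "1 \<le> i"
  shows "avg m t (dev i) = 0"
proof (induction t)
  case 0
  show ?case by (simp add: dev_def cost_def older_def)
next
  case (Suc t)
  have "(\<Sum>s<m. dev i (s # xs)) / real m = dev i xs" if "set xs \<subseteq> {..<m}" for xs
  proof (cases "active i xs")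
    case False
    then show ?thesis using m_pos by (simp add: dev_Cons)
  next
    case True
    define a where "a = real (card (occ i xs))"
    have a: "a < real m" using occ_less[OF True assms] n_less_m by (simp add: a_def)
    have "(\<Sum>s<m. dev i (s # xs)) =
        (\<Sum>s<m. if s \<in> occ i xs then dev i xs + 1 else dev i xs + 1 - real m / (real m - a))"
      using True by (intro sum.cong) (auto simp: dev_Cons a_def)
    also have "\<dots> = a * (dev i xs + 1) + (real m - a) * (dev i xs + 1 - real m / (real m - a))"
      unfolding a_def using occ_subset[of i xs] that by (intro sum_if_mem) auto
    also have "\<dots> = real m * dev i xs"
      using a by (simp add: field_simps)
    finally show ?thesis using m_pos by simp
  qed
  then have "avg m (Suc t) (dev i) = avg m t (dev i)"
    unfolding avg_Suc by (intro avg_cong) auto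
  then show ?case using Suc by simp
qed

lemma ratio_le_wait_bound: "a < n \<Longrightarrow> real m / (real m - real a) \<le> wait_bound"
  unfolding wait_bound_def using n_less_m by (intro divide_left_mono) auto

text \<open>Martingale increments are orthogonal, so their conditional variances add up. An active
  probe contributes \<open>m / (m - a) - 1\<close>, which is at most \<open>wait_bound\<close>;
  other steps contribute nothing.\<close>

lemma avg_dev_square:
  assumes "1 \<le> i"
  shows "avg m t (\<lambda>xs. (dev i xs)\<^sup>2) \<le> wait_bound * avg m t (\<lambda>xs. real (probes i xs))"
proof (induction t)
  case 0
  show ?case by (simp add: dev_def cost_def older_def)
next
  case (Suc t)
  have "(\<Sum>s<m. (dev i (s # xs))\<^sup>2) / real m
      \<le> (dev i xs)\<^sup>2 + wait_bound * of_bool (active i xs)" if "set xs \<subseteq> {..<m}" for xs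
  proof (cases "active i xs")
    case False
    then show ?thesis using m_pos by (simp add: dev_Cons)
  next
    case True
    define a where "a = real (card (occ i xs))"
    define d where "d = dev i xs"
    have a: "a < real m" using occ_less[OF True assms] n_less_m by (simp add: a_def)
    have "(\<Sum>s<m. (dev i (s # xs))\<^sup>2) =
        (\<Sum>s<m. if s \<in> occ i xs then (d + 1)\<^sup>2 else (d + 1 - real m / (real m - a))\<^sup>2)"
      using True by (intro sum.cong) (auto simp: dev_Cons a_def d_def)
    also have "\<dots> = a * (d + 1)\<^sup>2 + (real m - a) * (d + 1 - real m / (real m - a))\<^sup>2"
      unfolding a_def using occ_subset[of i xs] that by (intro sum_if_mem) auto
    also have "(real m - a) * (d + 1 - real m / (real m - a))\<^sup>2 =
        (real m - a) * (d + 1)\<^sup>2 - 2 * real m * (d + 1) + real m * (real m / (real m - a))"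
    proof -
      define b where "b = real m - a"
      have "0 < b" using a by (simp add: b_def)
      then show ?thesis unfolding b_def[symmetric] by (simp add: power2_eq_square field_simps)
    qed
    also have "a * (d + 1)\<^sup>2 + \<dots> = real m * (d\<^sup>2 - 1 + real m / (real m - a))"
      by (simp add: power2_eq_square algebra_simps)
    finally have "(\<Sum>s<m. (dev i (s # xs))\<^sup>2) / real m = d\<^sup>2 - 1 + real m / (real m - a)"
      using m_pos by simp
    also have "real m / (real m - a) \<le> wait_bound"
      unfolding a_def by (rule ratio_le_wait_bound[OF occ_less[OF True assms]])
    finally show ?thesis using True by (simp add: d_def)
  qed
  then have "avg m (Suc t) (\<lambda>xs. (dev i xs)\<^sup>2)
      \<le> avg m t (\<lambda>xs. (dev i xs)\<^sup>2 + wait_bound * of_bool (active i xs))"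
    unfolding avg_Suc by (intro avg_mono) auto
  also have "\<dots> \<le> wait_bound * avg m t (\<lambda>xs. real (probes i xs)) + wait_bound * avg m t (\<lambda>xs. of_bool (active i xs))"
    using Suc by (simp add: avg_add avg_cmult)
  also have "\<dots> = wait_bound * avg m (Suc t) (\<lambda>xs. real (probes i xs))"
  proof -
    have "(\<Sum>s<m. real (probes i (s # xs))) / real m = real (probes i xs) + of_bool (active i xs)" for xs
      using m_pos by simp
    then show ?thesis unfolding avg_Suc by (simp add: avg_add distrib_left)
  qed
  finally show ?case .
qed

section \<open>Bounds on probe counts, fluctuations and termination\<close>

lemma cost_nonneg: "a \<le> n \<Longrightarrow> 0 \<le> cost a"
  unfolding cost_def using n_less_m by (intro sum_nonneg divide_nonneg_nonneg) auto

lemma cost_mono: "a \<le> b \<Longrightarrow> b \<le> n \<Longrightarrow> cost a \<le> cost b"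
  unfolding cost_def using n_less_m by (intro sum_mono2) auto

lemma cost_le: "a \<le> n \<Longrightarrow> cost a \<le> real n * wait_bound"
proof -
  assume "a \<le> n"
  then have "cost a \<le> cost n" by (rule cost_mono) simp
  also have "\<dots> \<le> (\<Sum>s<n. wait_bound)"
    unfolding cost_def by (intro sum_mono ratio_le_wait_bound) auto
  finally show ?thesis by simp
qed

lemma card_occ_le_n: "1 \<le> i \<Longrightarrow> card (occ i xs) \<le> n"
  using card_occ_le[of i xs] placed_le[of xs] by linarith

text \<open>As \<open>dev i\<close> has mean 0, the expected number of probes is the expected
  \<open>cost\<close>, which is bounded uniformly in \<open>t\<close>.\<close>

lemma avg_probes_le:
  assumes "1 \<le> i"
  shows "avg m t (\<lambda>xs. real (probes i xs)) \<le> real n * wait_bound"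
proof -
  have "avg m t (\<lambda>xs. real (probes i xs)) = avg m t (dev i) + avg m t (\<lambda>xs. cost (card (occ i xs)))"
    unfolding avg_add[symmetric] by (simp add: dev_def)
  also have "\<dots> \<le> avg m t (\<lambda>xs. real n * wait_bound)"
    using avg_dev[OF assms] by (auto intro!: avg_mono cost_le card_occ_le_n assms)
  finally show ?thesis by (simp add: avg_const[OF m_pos])
qed

definition spread :: real where
  "spread = real n / real m * wait_bound\<^sup>2 / sqrt (real m) + 1 / sqrt (real m)"

lemma avg_abs_dev_le:
  assumes "1 \<le> i"
  shows "avg m t (\<lambda>xs. \<bar>dev i xs\<bar> / real m) \<le> spread"
proof -
  \<comment> \<open>At fixed load the second moment of \<open>dev\<close> is of order
    \<open>m\<close>. This \<open>c\<close> balances the two terms of \<open>x^2 / c + c\<close>, so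
    that after division by \<open>m\<close> both are of order \<open>1 / sqrt m\<close>.\<close>
  define c where "c = sqrt (real m)"
  have c: "0 < c" "real m = c\<^sup>2" using m_pos by (simp_all add: c_def)
  have "\<bar>x\<bar> \<le> x\<^sup>2 / c + c" for x
  proof -
    have "0 \<le> (\<bar>x\<bar> - c)\<^sup>2 + \<bar>x\<bar> * c" using c by simp
    then have "\<bar>x\<bar> * c \<le> x\<^sup>2 + c\<^sup>2" by (simp add: power2_eq_square algebra_simps)
    then show ?thesis using c by (simp add: field_simps power2_eq_square)
  qed
  then have "avg m t (\<lambda>xs. \<bar>dev i xs\<bar> / real m)
      \<le> avg m t (\<lambda>xs. (1 / (c * real m)) * (dev i xs)\<^sup>2 + c / real m)"
    using m_pos by (intro avg_mono) (simp add: field_simps)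
  also have "\<dots> = (1 / (c * real m)) * avg m t (\<lambda>xs. (dev i xs)\<^sup>2) + c / real m"
    unfolding avg_add avg_cmult by (simp add: avg_const[OF m_pos])
  also have "avg m t (\<lambda>xs. (dev i xs)\<^sup>2) \<le> wait_bound * (real n * wait_bound)"
    using avg_dev_square[OF assms, of t] avg_probes_le[OF assms, of t] wait_bound_ge_1
    by (meson dual_order.trans mult_left_mono order.trans zero_le_one)
  finally show ?thesis
    using c(1) unfolding spread_def c_def[symmetric] c(2)
    by (simp add: field_simps power2_eq_square)
qed

lemma probes_unfinished: "placed (run xs) < n \<Longrightarrow> probes 1 xs = length xs"
proof (induction xs)
  case (Cons s xs)
  have "placed (run xs) \<le> placed (run (s # xs))"
    by (auto simp: step_def split: option.splits)
  then have "placed (run xs) < n" using Cons.prems by simp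
  moreover have "1 \<le> age (run xs)" using valid_run[of xs] by (simp add: valid_def)
  ultimately show ?case using Cons.IH by (simp add: active_def)
qed simp

text \<open>Markov's inequality: in an unfinished history all \<open>t\<close> probes are genuine,
  while their expected number is at most \<open>n * wait_bound\<close>.\<close>

lemma unfinished_le:
  assumes "0 < t"
  shows "unfinished t \<le> real n * wait_bound / real t"
proof -
  have "unfinished t \<le> avg m t (\<lambda>xs. (1 / real t) * real (probes 1 xs))"
    unfolding unfinished_def using probes_unfinished assms by (intro avg_mono) auto
  also have "\<dots> \<le> (1 / real t) * (real n * wait_bound)"
    unfolding avg_cmult using avg_probes_le[of 1 t] by (intro mult_left_mono) auto
  finally show ?thesis by simp
qed

text \<open>\<open>cost a / m\<close> is the lower Riemann sum with unit steps for the integral of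
  \<open>1 / (m - s)\<close> over \<open>s\<close> from 0 to \<open>a\<close>, which is
  \<open>- ln (1 - a / m)\<close>. Upper and lower sum differ by the telescoping amount
  \<open>1 / (m - a) - 1 / m\<close>.\<close>

lemma cost_ln:
  assumes "a \<le> n"
  shows "\<bar>cost a / real m + ln (1 - real a / real m)\<bar> \<le> wait_bound / real m"
proof -
  have "cost a / real m \<le> - ln (1 - real a / real m) \<and>
      - ln (1 - real a / real m) \<le> cost a / real m + (1 / (real m - real a) - 1 / real m)"
    using assms
  proof (induction a)
    case 0
    show ?case using m_pos by (simp add: cost_def)
  next
    case (Suc a)
    define x where "x = real m - real a"
    have x: "1 < x" using Suc.prems n_less_m by (simp add: x_def)
    have mx: "1 - real a / real m = x / real m" "1 - real (Suc a) / real m = (x - 1) / real m"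
      using m_pos by (simp_all add: x_def field_simps)
    have "cost (Suc a) / real m = cost a / real m + 1 / x"
      using m_pos by (simp add: cost_def x_def field_simps)
    moreover have "ln (x / real m) = ln x - ln (real m)" "ln ((x - 1) / real m) = ln (x - 1) - ln (real m)"
      using x m_pos by (simp_all add: ln_div)
    moreover have "ln (x - 1) - ln x \<le> - (1 / x)"
      using ln_le_minus_one[of "(x - 1) / x"] x by (simp add: ln_div field_simps)
    moreover have "ln x - ln (x - 1) \<le> 1 / (x - 1)"
      using ln_le_minus_one[of "x / (x - 1)"] x by (simp add: ln_div field_simps)
    moreover have mx': "real m - real (Suc a) = x - 1" by (simp add: x_def)
    moreover have "cost a / real m \<le> - ln (x / real m)"
        "- ln (x / real m) \<le> cost a / real m + (1 / x - 1 / real m)"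
      using Suc mx(1) by (simp_all add: x_def[symmetric])
    ultimately show ?case unfolding mx(2) mx' by linarith
  qed
  moreover have "1 / (real m - real a) \<le> 1 / (real m - real n)"
    using assms n_less_m by (intro divide_left_mono) auto
  moreover have "wait_bound / real m = 1 / (real m - real n)" using m_pos by (simp add: wait_bound_def)
  moreover have "0 \<le> 1 / real m" by simp
  ultimately show ?thesis by linarith
qed

section \<open>Transfer of errors from one age to the next\<close>

definition probe_error :: "nat \<Rightarrow> nat \<Rightarrow> real \<Rightarrow> real" where
  "probe_error t i u = avg m t (\<lambda>xs. \<bar>real (probes i xs) / real m - u\<bar>)"

definition occ_error :: "nat \<Rightarrow> nat \<Rightarrow> real \<Rightarrow> real" where
  "occ_error t i u = avg m t (\<lambda>xs. \<bar>real (card (occ i xs)) / real m - u\<bar>)"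

text \<open>For age 1 the number of slots hit is deterministic at the end, namely \<open>n\<close>.
  The terms account for the fluctuation of \<open>dev 1\<close>, for unfinished histories, for
  replacing \<open>cost n\<close> by a logarithm, and for the distance of that logarithm from
  \<open>u\<close>.\<close>

lemma probe_error_one:
  "probe_error t 1 u \<le> spread + wait_bound * unfinished t + wait_bound / real m + \<bar>- ln (1 - real n / real m) - u\<bar>"
proof -
  let ?K = "wait_bound / real m + \<bar>- ln (1 - real n / real m) - u\<bar>"
  have "\<bar>real (probes 1 xs) / real m - u\<bar>
      \<le> \<bar>dev 1 xs\<bar> / real m + wait_bound * of_bool (placed (run xs) < n) + ?K" for xs
  proof -
    have p: "real (probes 1 xs) / real m = dev 1 xs / real m + cost (placed (run xs)) / real m"
      using card_occ_one[of xs] by (simp add: dev_def flip: add_divide_distrib)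
    have d: "\<bar>dev 1 xs / real m\<bar> = \<bar>dev 1 xs\<bar> / real m" by simp
    have n: "\<bar>cost n / real m - u\<bar> \<le> ?K" using cost_ln[of n] by simp
    have "\<bar>cost (placed (run xs)) / real m - cost n / real m\<bar> \<le> wait_bound * of_bool (placed (run xs) < n)"
    proof (cases "placed (run xs) < n")
      case True
      have "cost n / real m \<le> real n * wait_bound / real m"
        by (intro divide_right_mono cost_le) auto
      also have "\<dots> \<le> wait_bound" using n_less_m wait_bound_ge_1 by (simp add: field_simps)
      finally have "cost n / real m \<le> wait_bound" .
      moreover have "cost (placed (run xs)) / real m \<le> cost n / real m"
        using True by (intro divide_right_mono cost_mono) auto
      moreover have "0 \<le> cost (placed (run xs)) / real m"
        using True cost_nonneg[of "placed (run xs)"] by simp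
      ultimately show ?thesis using True by simp
    next
      case False
      then have "placed (run xs) = n" using placed_le[of xs] by simp
      then show ?thesis by simp
    qed
    then show ?thesis using p d n by linarith
  qed
  then have "probe_error t 1 u
      \<le> avg m t (\<lambda>xs. \<bar>dev 1 xs\<bar> / real m + wait_bound * of_bool (placed (run xs) < n) + ?K)"
    unfolding probe_error_def by (intro avg_mono)
  also have "\<dots> = avg m t (\<lambda>xs. \<bar>dev 1 xs\<bar> / real m) + wait_bound * unfinished t + ?K"
    unfolding avg_add avg_cmult unfinished_def by (simp add: avg_const[OF m_pos])
  finally show ?thesis using avg_abs_dev_le[of 1 t] by simp
qed

text \<open>Inverts the logarithmic relation between probes and occupied slots. Since
  \<open>exp (- x)\<close> is 1-Lipschitz for \<open>x \<ge> 0\<close>, the inversion does not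
  enlarge the error.\<close>

lemma occ_error_le:
  assumes "1 \<le> i" "0 \<le> u"
  shows "occ_error t i (1 - exp (- u)) \<le> probe_error t i u + spread + wait_bound / real m"
proof -
  have "\<bar>real (card (occ i xs)) / real m - (1 - exp (- u))\<bar>
      \<le> \<bar>real (probes i xs) / real m - u\<bar> + \<bar>dev i xs\<bar> / real m + wait_bound / real m" for xs
  proof -
    let ?a = "card (occ i xs)"
    have a: "?a \<le> n" by (rule card_occ_le_n[OF assms(1)])
    then have "real ?a < real m" using n_less_m by linarith
    then have pos: "0 < 1 - real ?a / real m" by simp
    define v where "v = - ln (1 - real ?a / real m)"
    have v: "exp (- v) = 1 - real ?a / real m" using pos by (simp add: v_def)
    have v0: "0 \<le> v" using pos by (simp add: v_def)
    have "real (probes i xs) / real m = dev i xs / real m + cost ?a / real m"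
      by (simp add: dev_def flip: add_divide_distrib)
    moreover have "\<bar>dev i xs / real m\<bar> = \<bar>dev i xs\<bar> / real m" by simp
    moreover have "\<bar>cost ?a / real m - v\<bar> \<le> wait_bound / real m"
      using cost_ln[OF a] by (simp add: v_def)
    moreover have "real ?a / real m - (1 - exp (- u)) = exp (- u) - exp (- v)" by (simp add: v)
    moreover have "\<bar>exp (- u) - exp (- v)\<bar> \<le> \<bar>u - v\<bar>" by (rule exp_lipschitz[OF assms(2) v0])
    ultimately show ?thesis by linarith
  qed
  then have "occ_error t i (1 - exp (- u))
      \<le> avg m t (\<lambda>xs. \<bar>real (probes i xs) / real m - u\<bar> + \<bar>dev i xs\<bar> / real m + wait_bound / real m)"
    unfolding occ_error_def by (intro avg_mono)
  also have "\<dots> = probe_error t i u + avg m t (\<lambda>xs. \<bar>dev i xs\<bar> / real m) + wait_bound / real m"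
    unfolding avg_add probe_error_def by (simp add: avg_const[OF m_pos])
  finally show ?thesis using avg_abs_dev_le[OF assms(1), of t] by simp
qed

text \<open>Divide \<open>probes_eq\<close> by \<open>m\<close>; the key in hand accounts for
  \<open>1 / m\<close>.\<close>

lemma probe_error_Suc:
  assumes "1 \<le> i"
  shows "probe_error t (Suc i) (u - v) \<le> probe_error t i u + occ_error t i v + 1 / real m"
proof -
  have "\<bar>real (probes (Suc i) xs) / real m - (u - v)\<bar>
      \<le> \<bar>real (probes i xs) / real m - u\<bar> + \<bar>real (card (occ i xs)) / real m - v\<bar> + 1 / real m" for xs
  proof -
    have "real (probes i xs) / real m =
        real (probes (Suc i) xs) / real m + real (card (occ i xs)) / real m
        + of_bool (i < age (run xs)) / real m"
      unfolding probes_eq[OF assms, of xs] by (simp flip: add_divide_distrib)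
    moreover have "0 \<le> of_bool (i < age (run xs)) / real m"
        "of_bool (i < age (run xs)) / real m \<le> 1 / real m"
      by (auto intro: divide_right_mono)
    ultimately show ?thesis by linarith
  qed
  then have "probe_error t (Suc i) (u - v)
      \<le> avg m t (\<lambda>xs. \<bar>real (probes i xs) / real m - u\<bar> + \<bar>real (card (occ i xs)) / real m - v\<bar> + 1 / real m)"
    unfolding probe_error_def by (intro avg_mono)
  also have "\<dots> = probe_error t i u + occ_error t i v + 1 / real m"
    unfolding avg_add probe_error_def occ_error_def by (simp add: avg_const[OF m_pos])
  finally show ?thesis .
qed

lemma avg_occ_close: "\<bar>avg m t (\<lambda>xs. real (card (occ i xs))) / real m - u\<bar> \<le> occ_error t i u"
proof -
  have "avg m t (\<lambda>xs. real (card (occ i xs))) / real m - u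
      = avg m t (\<lambda>xs. (1 / real m) * real (card (occ i xs)) - u)"
    unfolding avg_diff avg_cmult by (simp add: avg_const[OF m_pos])
  then show ?thesis
    using abs_avg_le[of m t "\<lambda>xs. (1 / real m) * real (card (occ i xs)) - u"]
    by (simp add: occ_error_def)
qed

text \<open>By \<open>valid\<close> a key sits in at most one slot, so keys of age \<open>i\<close>
  can be counted by their slots.\<close>

lemma card_keys_of_age:
  "card {x. x < n \<and> (\<exists>s. tbl (run xs) s = Some (x, i))} = card (occ i xs) - card (occ (Suc i) xs)"
proof -
  let ?T = "tbl (run xs)"
  let ?B = "{s. \<exists>x. ?T s = Some (x, i)}"
  have v: "valid (run xs)" by (rule valid_run)
  have lt: "x < n" if "?T s = Some (x, l)" for x s l
  proof -
    have "x \<le> placed (run xs)" "x \<noteq> key (run xs)" "placed (run xs) = n \<longrightarrow> key (run xs) = n"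
      using v that by (auto simp: valid_def)
    then show ?thesis using placed_le[of xs] by linarith
  qed
  have "{x. x < n \<and> (\<exists>s. ?T s = Some (x, i))} = (\<lambda>s. fst (the (?T s))) ` ?B"
    using lt by (force simp: image_iff)
  moreover have "inj_on (\<lambda>s. fst (the (?T s))) ?B"
    using v unfolding valid_def by (intro inj_onI) fastforce
  moreover have "?B = occ i xs - occ (Suc i) xs"
    by (auto simp: older_def not_less_eq_eq)
  moreover have "occ (Suc i) xs \<subseteq> occ i xs" by (auto simp: older_def)
  ultimately show ?thesis by (simp add: card_image card_Diff_subset)
qed

lemma age_prob_close:
  assumes "0 < n"
  shows "\<bar>age_prob tie n m i -
      (avg m t (\<lambda>xs. real (card (occ i xs))) - avg m t (\<lambda>xs. real (card (occ (Suc i) xs)))) / real n\<bar>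
    \<le> unfinished t"
proof -
  let ?p = "\<lambda>x. measure (probe_space m) {h. has_age tie h n x i}"
  let ?q = "\<lambda>x. avg m t (\<lambda>xs. of_bool (\<exists>s. tbl (run xs) s = Some (x, i)))"
  have "(\<Sum>x<n. ?q x) = avg m t (\<lambda>xs. \<Sum>x<n. of_bool (\<exists>s. tbl (run xs) s = Some (x, i)))"
    by (rule avg_sum[symmetric])
  also have "\<dots> = avg m t (\<lambda>xs. real (card (occ i xs)) - real (card (occ (Suc i) xs)))"
  proof (rule avg_cong)
    fix xs
    have "card (occ (Suc i) xs) \<le> card (occ i xs)"
      by (rule card_mono[OF finite_occ]) (auto simp: older_def)
    moreover have "{..<n} \<inter> {x. \<exists>s. tbl (run xs) s = Some (x, i)} =
        {x. x < n \<and> (\<exists>s. tbl (run xs) s = Some (x, i))}" by auto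
    ultimately show "(\<Sum>x<n. of_bool (\<exists>s. tbl (run xs) s = Some (x, i))) =
        real (card (occ i xs)) - real (card (occ (Suc i) xs))"
      using card_keys_of_age[of xs i] by (simp add: of_nat_diff)
  qed
  finally have q: "(\<Sum>x<n. ?q x) =
      avg m t (\<lambda>xs. real (card (occ i xs))) - avg m t (\<lambda>xs. real (card (occ (Suc i) xs)))"
    by (simp add: avg_diff)
  have "\<bar>(\<Sum>x<n. ?p x) - (\<Sum>x<n. ?q x)\<bar> \<le> (\<Sum>x<n. \<bar>?p x - ?q x\<bar>)"
    unfolding sum_subtractf[symmetric] by (rule sum_abs)
  also have "\<dots> \<le> (\<Sum>x<n. unfinished t)"
    unfolding unfinished_def by (intro sum_mono prob_has_age)
  finally have "\<bar>(\<Sum>x<n. ?p x) - (\<Sum>x<n. ?q x)\<bar> / real n \<le> unfinished t"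
    using assms by (simp add: field_simps)
  then show ?thesis
    unfolding age_prob_eq[OF assms] q[symmetric]
    by (simp add: abs_divide flip: diff_divide_distrib)
qed

text \<open>This bound and the next are relative to \<open>n\<close>. They serve the case of load 0,
  where estimates on the scale of \<open>m\<close> say nothing about fractions of keys.\<close>

lemma avg_occ_one: "real n * (1 - unfinished t) \<le> avg m t (\<lambda>xs. real (card (occ 1 xs)))"
proof -
  have "avg m t (\<lambda>xs. real n - real n * of_bool (placed (run xs) < n))
      \<le> avg m t (\<lambda>xs. real (card (occ 1 xs)))"
    unfolding card_occ_one using placed_le by (intro avg_mono) (auto simp: not_less intro: order_antisym)
  then show ?thesis
    by (simp add: avg_diff avg_cmult avg_const[OF m_pos] unfinished_def algebra_simps)
qed

text \<open>Every slot counted was hit by a probe of age at least 2. There are at most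
  \<open>probes 1 xs - card (occ 1 xs)\<close> such probes: the surplus of all probes over the
  occupied slots.\<close>

lemma avg_occ_ge_two:
  assumes "2 \<le> i"
  shows "avg m t (\<lambda>xs. real (card (occ i xs))) \<le> real n * (wait_bound - 1 + unfinished t)"
proof -
  have "real (card (occ i xs)) \<le> real (probes 1 xs) - real (card (occ 1 xs))" for xs
  proof -
    have "card (occ i xs) \<le> card (occ 2 xs)"
      using assms by (intro card_mono finite_occ) (auto simp: older_def intro: le_trans)
    also have "\<dots> \<le> probes 2 xs" using probes_eq[of 2 xs] by simp
    also have "probes 2 xs + card (occ 1 xs) \<le> probes 1 xs"
      using probes_eq[of 1 xs] by (simp add: numeral_2_eq_2)
    finally show ?thesis by simp
  qed
  then have "avg m t (\<lambda>xs. real (card (occ i xs)))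
      \<le> avg m t (\<lambda>xs. real (probes 1 xs)) - avg m t (\<lambda>xs. real (card (occ 1 xs)))"
    unfolding avg_diff[symmetric] by (intro avg_mono)
  then show ?thesis
    using avg_occ_one[of t] avg_probes_le[of 1 t] by (simp add: algebra_simps)
qed

end

section \<open>Passage to the limit\<close>

text \<open>The limit of \<open>P\<^sub>i / m\<close> for \<open>i = k + 1\<close>, and at the same
  time the double tail of the theorem.\<close>

primrec limit_probes :: "real \<Rightarrow> nat \<Rightarrow> real" where
  "limit_probes \<alpha> 0 = ln (1 / (1 - \<alpha>))"
| "limit_probes \<alpha> (Suc k) = limit_probes \<alpha> k - 1 + exp (- limit_probes \<alpha> k)"

lemma limit_probes_nonneg:
  assumes "0 \<le> \<alpha>" "\<alpha> < 1"
  shows "0 \<le> limit_probes \<alpha> k"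
proof (cases k)
  case 0
  then show ?thesis using assms by (simp add: ln_div)
next
  case (Suc j)
  then show ?thesis using exp_ge_add_one_self[of "- limit_probes \<alpha> j"] by simp
qed

text \<open>The sequence is nonnegative and decreasing, and a limit \<open>l\<close> satisfies
  \<open>l = l - 1 + exp (- l)\<close>, hence vanishes. Both tail sums below telescope to this
  limit.\<close>

lemma limit_probes_tendsto_0:
  assumes "0 \<le> \<alpha>" "\<alpha> < 1"
  shows "limit_probes \<alpha> \<longlonglongrightarrow> 0"
proof -
  have "decseq (limit_probes \<alpha>)"
    using limit_probes_nonneg[OF assms] by (auto simp: decseq_Suc_iff)
  then obtain l where l: "limit_probes \<alpha> \<longlonglongrightarrow> l"
    using decseq_convergent[of "limit_probes \<alpha>" 0] limit_probes_nonneg[OF assms] by blast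
  have "(\<lambda>k. limit_probes \<alpha> (Suc k)) \<longlonglongrightarrow> l - 1 + exp (- l)"
    unfolding limit_probes.simps by (intro tendsto_intros l)
  moreover have "(\<lambda>k. limit_probes \<alpha> (Suc k)) \<longlonglongrightarrow> l"
    using l by (rule LIMSEQ_Suc)
  ultimately have "l = l - 1 + exp (- l)" by (rule LIMSEQ_unique[rotated])
  then have "l = 0" by simp
  then show ?thesis using l by simp
qed

text \<open>Note the shift: \<open>limit_probes \<alpha> k\<close> belongs to age \<open>k + 1\<close>.\<close>

definition limit_share :: "real \<Rightarrow> nat \<Rightarrow> real" where
  "limit_share \<alpha> i = exp (- limit_probes \<alpha> i) - exp (- limit_probes \<alpha> (i - 1))"

lemma limit_share_sums:
  assumes "0 \<le> \<alpha>" "\<alpha> < 1"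
  shows "(\<lambda>j. limit_share \<alpha> (Suc k + j)) sums (1 - exp (- limit_probes \<alpha> k))"
proof -
  have "(\<lambda>j. exp (- limit_probes \<alpha> (j + k))) \<longlonglongrightarrow> exp (- 0)"
    by (intro tendsto_intros LIMSEQ_ignore_initial_segment limit_probes_tendsto_0 assms)
  then have "(\<lambda>j. exp (- limit_probes \<alpha> (Suc j + k)) - exp (- limit_probes \<alpha> (j + k)))
      sums (exp (- 0) - exp (- limit_probes \<alpha> (0 + k)))"
    by (rule telescope_sums)
  then show ?thesis by (simp add: limit_share_def add.commute del: limit_probes.simps)
qed

text \<open>The first tail is \<open>1 - exp (- limit_probes \<alpha> k)\<close>; the recurrence
  rewrites it as a difference, so that the second tail telescopes as well.\<close>

lemma tail_limit_share:
  assumes "0 \<le> \<alpha>" "\<alpha> < 1"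
  shows "tail (limit_share \<alpha>) (Suc k) = limit_probes \<alpha> k - limit_probes \<alpha> (Suc k)"
  using sums_unique[OF limit_share_sums[OF assms, of k]] by (simp add: tail_def)

lemma tail_limit_share_sums:
  assumes "0 \<le> \<alpha>" "\<alpha> < 1"
  shows "(\<lambda>j. tail (limit_share \<alpha>) (Suc k + j)) sums limit_probes \<alpha> k"
proof -
  have "(\<lambda>j. limit_probes \<alpha> (j + k)) \<longlonglongrightarrow> 0"
    by (intro LIMSEQ_ignore_initial_segment limit_probes_tendsto_0 assms)
  then have "(\<lambda>j. limit_probes \<alpha> (j + k) - limit_probes \<alpha> (Suc j + k))
      sums (limit_probes \<alpha> (0 + k) - 0)"
    by (rule telescope_sums')
  then show ?thesis
    by (simp add: tail_limit_share[OF assms] add.commute del: limit_probes.simps)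
qed

lemma tail_tail_limit_share:
  assumes "0 \<le> \<alpha>" "\<alpha> < 1"
  shows "tail (tail (limit_share \<alpha>)) (Suc k) = limit_probes \<alpha> k"
  using sums_unique[OF tail_limit_share_sums[OF assms, of k]] by (simp add: tail_def)

lemma summable_limit_share:
  assumes "0 \<le> \<alpha>" "\<alpha> < 1"
  shows "summable (limit_share \<alpha>)" "summable (tail (limit_share \<alpha>))"
  using sums_summable[OF limit_share_sums[OF assms, of 0]]
    sums_summable[OF tail_limit_share_sums[OF assms, of 0]]
  by (simp_all add: summable_Suc_iff)

lemma tendsto_0_squeeze:
  fixes f g :: "nat \<Rightarrow> real"
  assumes "g \<longlonglongrightarrow> 0" "\<forall>\<^sub>F r in sequentially. f r \<le> g r" "\<forall>\<^sub>F r in sequentially. 0 \<le> f r"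
  shows "f \<longlonglongrightarrow> 0"
  by (rule tendsto_sandwich[OF assms(3,2) tendsto_const assms(1)])

section \<open>Convergence along a sequence of growing tables\<close>

locale load_factor =
  fixes \<alpha> :: real and n m :: "nat \<Rightarrow> nat" and tie :: "nat \<Rightarrow> nat \<Rightarrow> bool"
  assumes \<alpha>_nonneg: "0 \<le> \<alpha>" and \<alpha>_less: "\<alpha> < 1"
    and n_top: "filterlim n at_top sequentially"
    and m_top: "filterlim m at_top sequentially"
    and ratio: "(\<lambda>r. real (n r) / real (m r)) \<longlonglongrightarrow> \<alpha>"
begin

lemma eventually_robin_hood: "\<forall>\<^sub>F r in sequentially. robin_hood (n r) (m r) \<and> 0 < n r"
proof -
  have "\<forall>\<^sub>F r in sequentially. 0 < n r" "\<forall>\<^sub>F r in sequentially. 0 < m r"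
    using n_top m_top by (auto simp: filterlim_at_top Suc_le_eq dest: spec[of _ 1])
  moreover have "\<forall>\<^sub>F r in sequentially. real (n r) / real (m r) < 1"
    using order_tendstoD(2)[OF ratio \<alpha>_less] .
  ultimately show ?thesis
    by eventually_elim (auto simp: robin_hood_def)
qed

text \<open>With \<open>m\<^sup>2\<close> steps the process is unfinished with probability \<open>O(1/m)\<close>.\<close>

abbreviation "t \<equiv> \<lambda>r. m r * m r"

lemma inverse_m: "(\<lambda>r. 1 / real (m r)) \<longlonglongrightarrow> 0"
  unfolding inverse_eq_divide[symmetric]
  by (rule tendsto_inverse_0_at_top) (rule filterlim_compose[OF filterlim_real_sequentially m_top])

lemma inverse_sqrt_m: "(\<lambda>r. 1 / sqrt (real (m r))) \<longlonglongrightarrow> 0"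
  using tendsto_real_sqrt[OF inverse_m] by (simp add: real_sqrt_divide)

lemma tendsto_wait_bound: "(\<lambda>r. robin_hood.wait_bound (n r) (m r)) \<longlonglongrightarrow> 1 / (1 - \<alpha>)"
proof -
  have "(\<lambda>r. 1 / (1 - real (n r) / real (m r))) \<longlonglongrightarrow> 1 / (1 - \<alpha>)"
    using \<alpha>_less by (intro tendsto_intros ratio) auto
  moreover have "\<forall>\<^sub>F r in sequentially. 1 / (1 - real (n r) / real (m r)) = robin_hood.wait_bound (n r) (m r)"
    using eventually_robin_hood
    by eventually_elim (auto simp: robin_hood.wait_bound_def robin_hood_def field_simps)
  ultimately show ?thesis by (rule Lim_transform_eventually)
qed

lemma tendsto_spread: "(\<lambda>r. robin_hood.spread (n r) (m r)) \<longlonglongrightarrow> 0"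
proof -
  let ?C = "\<lambda>r. robin_hood.wait_bound (n r) (m r)"
  have "(\<lambda>r. real (n r) / real (m r) * (?C r)\<^sup>2 * (1 / sqrt (real (m r))) + 1 / sqrt (real (m r)))
      \<longlonglongrightarrow> \<alpha> * (1 / (1 - \<alpha>))\<^sup>2 * 0 + 0"
    by (intro tendsto_intros ratio tendsto_wait_bound inverse_sqrt_m)
  moreover have "\<forall>\<^sub>F r in sequentially.
      real (n r) / real (m r) * (?C r)\<^sup>2 * (1 / sqrt (real (m r))) + 1 / sqrt (real (m r))
      = robin_hood.spread (n r) (m r)"
    using eventually_robin_hood by eventually_elim (simp add: robin_hood.spread_def)
  ultimately show ?thesis using Lim_transform_eventually by fastforce
qed

lemma tendsto_unfinished: "(\<lambda>r. robin_hood.unfinished tie (n r) (m r) (t r)) \<longlonglongrightarrow> 0"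
proof (rule tendsto_0_squeeze)
  let ?B = "\<lambda>r. real (n r) / real (m r) * robin_hood.wait_bound (n r) (m r) * (1 / real (m r))"
  have "?B \<longlonglongrightarrow> \<alpha> * (1 / (1 - \<alpha>)) * 0"
    by (intro tendsto_intros ratio tendsto_wait_bound inverse_m)
  then show "?B \<longlonglongrightarrow> 0" by simp
  show "\<forall>\<^sub>F r in sequentially. robin_hood.unfinished tie (n r) (m r) (t r) \<le> ?B r"
    using eventually_robin_hood
  proof eventually_elim
    case (elim r)
    then interpret robin_hood tie "n r" "m r" by simp
    show ?case using unfinished_le[of "t r"] m_pos by simp
  qed
  show "\<forall>\<^sub>F r in sequentially. 0 \<le> robin_hood.unfinished tie (n r) (m r) (t r)"
    using eventually_robin_hood
    by eventually_elim (auto simp: robin_hood.unfinished_def intro: avg_nonneg)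
qed

lemma tendsto_wait_bound_over_m: "(\<lambda>r. robin_hood.wait_bound (n r) (m r) / real (m r)) \<longlonglongrightarrow> 0"
  using tendsto_mult[OF tendsto_wait_bound inverse_m] by simp

lemma tendsto_occ_error:
  assumes "(\<lambda>r. robin_hood.probe_error tie (n r) (m r) (t r) i u) \<longlonglongrightarrow> 0" "1 \<le> i" "0 \<le> u"
  shows "(\<lambda>r. robin_hood.occ_error tie (n r) (m r) (t r) i (1 - exp (- u))) \<longlonglongrightarrow> 0"
proof (rule tendsto_0_squeeze)
  let ?B = "\<lambda>r. robin_hood.probe_error tie (n r) (m r) (t r) i u
    + robin_hood.spread (n r) (m r) + robin_hood.wait_bound (n r) (m r) / real (m r)"
  have "?B \<longlonglongrightarrow> 0 + 0 + 0"
    by (intro tendsto_intros assms tendsto_spread tendsto_wait_bound_over_m)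
  then show "?B \<longlonglongrightarrow> 0" by simp
  show "\<forall>\<^sub>F r in sequentially. robin_hood.occ_error tie (n r) (m r) (t r) i (1 - exp (- u)) \<le> ?B r"
    using eventually_robin_hood by eventually_elim (use assms(2,3) in \<open>auto intro: robin_hood.occ_error_le\<close>)
  show "\<forall>\<^sub>F r in sequentially. 0 \<le> robin_hood.occ_error tie (n r) (m r) (t r) i (1 - exp (- u))"
    using eventually_robin_hood
    by eventually_elim (auto simp: robin_hood.occ_error_def intro: avg_nonneg)
qed

text \<open>Induction on the age: control of the probes gives control of the occupied slots of the
  same age, and both together control the probes of the next age.\<close>

lemma tendsto_probe_error:
  "(\<lambda>r. robin_hood.probe_error tie (n r) (m r) (t r) (Suc k) (limit_probes \<alpha> k)) \<longlonglongrightarrow> 0"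
proof (induction k)
  case 0
  let ?L = "limit_probes \<alpha> 0"
  show ?case
  proof (rule tendsto_0_squeeze)
    let ?B = "\<lambda>r. robin_hood.spread (n r) (m r)
      + robin_hood.wait_bound (n r) (m r) * robin_hood.unfinished tie (n r) (m r) (t r)
      + robin_hood.wait_bound (n r) (m r) / real (m r) + \<bar>- ln (1 - real (n r) / real (m r)) - ?L\<bar>"
    have "?B \<longlonglongrightarrow> 0 + 1 / (1 - \<alpha>) * 0 + 0 + \<bar>- ln (1 - \<alpha>) - ?L\<bar>"
      using \<alpha>_less
      by (intro tendsto_intros tendsto_spread tendsto_wait_bound tendsto_unfinished tendsto_wait_bound_over_m ratio) auto
    then show "?B \<longlonglongrightarrow> 0" using \<alpha>_less by (simp add: ln_div)
    show "\<forall>\<^sub>F r in sequentially. robin_hood.probe_error tie (n r) (m r) (t r) (Suc 0) ?L \<le> ?B r"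
      using eventually_robin_hood
      by eventually_elim (auto intro: robin_hood.probe_error_one[unfolded One_nat_def])
    show "\<forall>\<^sub>F r in sequentially. 0 \<le> robin_hood.probe_error tie (n r) (m r) (t r) (Suc 0) ?L"
      using eventually_robin_hood
      by eventually_elim (auto simp: robin_hood.probe_error_def intro: avg_nonneg)
  qed
next
  case (Suc k)
  let ?u = "limit_probes \<alpha> k"
  have eq: "limit_probes \<alpha> (Suc k) = ?u - (1 - exp (- ?u))" by simp
  show ?case
    unfolding eq
  proof (rule tendsto_0_squeeze)
    let ?B = "\<lambda>r. robin_hood.probe_error tie (n r) (m r) (t r) (Suc k) ?u
      + robin_hood.occ_error tie (n r) (m r) (t r) (Suc k) (1 - exp (- ?u)) + 1 / real (m r)"
    have "?B \<longlonglongrightarrow> 0 + 0 + 0"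
      by (intro tendsto_intros Suc tendsto_occ_error inverse_m limit_probes_nonneg \<alpha>_nonneg \<alpha>_less) simp
    then show "?B \<longlonglongrightarrow> 0" by simp
    show "\<forall>\<^sub>F r in sequentially.
        robin_hood.probe_error tie (n r) (m r) (t r) (Suc (Suc k)) (?u - (1 - exp (- ?u))) \<le> ?B r"
      using eventually_robin_hood by eventually_elim (auto intro: robin_hood.probe_error_Suc)
    show "\<forall>\<^sub>F r in sequentially.
        0 \<le> robin_hood.probe_error tie (n r) (m r) (t r) (Suc (Suc k)) (?u - (1 - exp (- ?u)))"
      using eventually_robin_hood
      by eventually_elim (auto simp: robin_hood.probe_error_def intro: avg_nonneg)
  qed
qed

section \<open>From occupied slots to age probabilities\<close>

definition mean_occ :: "nat \<Rightarrow> nat \<Rightarrow> real" where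
  "mean_occ i r = avg (m r) (t r) (\<lambda>xs. real (card (older i (tbl (robin_hood.run tie (n r) xs)))))"

lemma tendsto_mean_occ:
  "(\<lambda>r. mean_occ (Suc k) r / real (m r)) \<longlonglongrightarrow> 1 - exp (- limit_probes \<alpha> k)"
proof -
  have "(\<lambda>r. mean_occ (Suc k) r / real (m r) - (1 - exp (- limit_probes \<alpha> k))) \<longlonglongrightarrow> 0"
  proof (rule Lim_null_comparison)
    show "(\<lambda>r. robin_hood.occ_error tie (n r) (m r) (t r) (Suc k) (1 - exp (- limit_probes \<alpha> k))) \<longlonglongrightarrow> 0"
      by (intro tendsto_occ_error tendsto_probe_error limit_probes_nonneg \<alpha>_nonneg \<alpha>_less) simp
    show "\<forall>\<^sub>F r in sequentially. norm (mean_occ (Suc k) r / real (m r) - (1 - exp (- limit_probes \<alpha> k)))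
        \<le> robin_hood.occ_error tie (n r) (m r) (t r) (Suc k) (1 - exp (- limit_probes \<alpha> k))"
      using eventually_robin_hood unfolding mean_occ_def real_norm_def
      by eventually_elim (auto intro: robin_hood.avg_occ_close)
  qed
  then show ?thesis by (simp add: LIM_zero_iff)
qed

lemma tendsto_age_prob_mean_occ:
  "(\<lambda>r. age_prob tie (n r) (m r) i - (mean_occ i r - mean_occ (Suc i) r) / real (n r)) \<longlonglongrightarrow> 0"
proof (rule Lim_null_comparison[OF _ tendsto_unfinished])
  show "\<forall>\<^sub>F r in sequentially.
      norm (age_prob tie (n r) (m r) i - (mean_occ i r - mean_occ (Suc i) r) / real (n r))
      \<le> robin_hood.unfinished tie (n r) (m r) (t r)"
    using eventually_robin_hood unfolding mean_occ_def real_norm_def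
    by eventually_elim (auto intro: robin_hood.age_prob_close)
qed

lemma tendsto_age_prob:
  assumes "(\<lambda>r. mean_occ i r / real (n r)) \<longlonglongrightarrow> x" "(\<lambda>r. mean_occ (Suc i) r / real (n r)) \<longlonglongrightarrow> y"
  shows "(\<lambda>r. age_prob tie (n r) (m r) i) \<longlonglongrightarrow> x - y"
  using tendsto_add[OF tendsto_age_prob_mean_occ[of i] tendsto_diff[OF assms]]
  by (simp add: diff_divide_distrib)

text \<open>Dividing by \<open>n / m\<close>, which tends to \<open>\<alpha> > 0\<close>, turns
  fractions of slots into fractions of keys.\<close>

lemma tendsto_age_prob_pos:
  assumes "0 < \<alpha>"
  shows "(\<lambda>r. age_prob tie (n r) (m r) (Suc k)) \<longlonglongrightarrow> limit_share \<alpha> (Suc k) / \<alpha>"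
proof -
  have lim: "(\<lambda>r. mean_occ (Suc k) r / real (n r)) \<longlonglongrightarrow> (1 - exp (- limit_probes \<alpha> k)) / \<alpha>" for k
  proof (rule Lim_transform_eventually)
    show "(\<lambda>r. (mean_occ (Suc k) r / real (m r)) / (real (n r) / real (m r)))
        \<longlonglongrightarrow> (1 - exp (- limit_probes \<alpha> k)) / \<alpha>"
      using assms by (intro tendsto_intros tendsto_mean_occ ratio) auto
    show "\<forall>\<^sub>F r in sequentially. (mean_occ (Suc k) r / real (m r)) / (real (n r) / real (m r))
        = mean_occ (Suc k) r / real (n r)"
      using eventually_robin_hood by eventually_elim (auto simp: robin_hood_def)
  qed
  show ?thesis
    using tendsto_age_prob[OF lim[of k] lim[of "Suc k"]]
    by (simp add: limit_share_def del: limit_probes.simps flip: diff_divide_distrib)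
qed

text \<open>Here \<open>wait_bound\<close> tends to 1, so on average a key needs one probe up to a
  vanishing surplus, which bounds the share of keys of age at least 2.\<close>

lemma tendsto_age_prob_zero:
  assumes "\<alpha> = 0"
  shows "(\<lambda>r. age_prob tie (n r) (m r) (Suc k)) \<longlonglongrightarrow> of_bool (k = 0)"
proof -
  have one: "(\<lambda>r. mean_occ 1 r / real (n r)) \<longlonglongrightarrow> 1"
  proof (rule tendsto_sandwich)
    show "(\<lambda>r. 1 - robin_hood.unfinished tie (n r) (m r) (t r)) \<longlonglongrightarrow> 1"
      using tendsto_diff[OF tendsto_const tendsto_unfinished, of 1] by simp
    show "\<forall>\<^sub>F r in sequentially. 1 - robin_hood.unfinished tie (n r) (m r) (t r) \<le> mean_occ 1 r / real (n r)"
      using eventually_robin_hood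
    proof eventually_elim
      case (elim r)
      then interpret robin_hood tie "n r" "m r" by simp
      show ?case using avg_occ_one[of "t r"] elim by (simp add: mean_occ_def field_simps)
    qed
    show "\<forall>\<^sub>F r in sequentially. mean_occ 1 r / real (n r) \<le> 1"
      using eventually_robin_hood
    proof eventually_elim
      case (elim r)
      then interpret robin_hood tie "n r" "m r" by simp
      have "mean_occ 1 r \<le> avg (m r) (t r) (\<lambda>_. real (n r))"
        unfolding mean_occ_def using card_occ_le_n[of 1] by (intro avg_mono) simp
      then show ?case using elim avg_const[OF m_pos] by simp
    qed
  qed simp
  have two: "(\<lambda>r. mean_occ i r / real (n r)) \<longlonglongrightarrow> 0" if "2 \<le> i" for i
  proof (rule tendsto_0_squeeze)
    let ?B = "\<lambda>r. robin_hood.wait_bound (n r) (m r) - 1 + robin_hood.unfinished tie (n r) (m r) (t r)"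
    have "?B \<longlonglongrightarrow> 1 / (1 - \<alpha>) - 1 + 0"
      by (intro tendsto_intros tendsto_wait_bound tendsto_unfinished)
    then show "?B \<longlonglongrightarrow> 0" using assms by simp
    show "\<forall>\<^sub>F r in sequentially. mean_occ i r / real (n r) \<le> ?B r"
      using eventually_robin_hood
    proof eventually_elim
      case (elim r)
      then interpret robin_hood tie "n r" "m r" by simp
      show ?case using avg_occ_ge_two[OF that, of "t r"] elim by (simp add: mean_occ_def field_simps)
    qed
    show "\<forall>\<^sub>F r in sequentially. 0 \<le> mean_occ i r / real (n r)"
      by (intro always_eventually allI) (auto simp: mean_occ_def intro!: divide_nonneg_nonneg avg_nonneg)
  qed
  show ?thesis
  proof (cases "k = 0")
    case True
    then show ?thesis
      using tendsto_age_prob[of 1 1 0] one two[of 2] by (simp add: numeral_2_eq_2)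
  next
    case False
    then show ?thesis
      using tendsto_age_prob[of "Suc k" 0 0] two[of "Suc k"] two[of "Suc (Suc k)"] by simp
  qed
qed

end

theorem theorem1:
  fixes \<alpha> :: real
    and n m :: "nat \<Rightarrow> nat"
    and tie :: "nat \<Rightarrow> nat \<Rightarrow> bool"
  assumes "0 \<le> \<alpha>" and "\<alpha> < 1"
    and "filterlim n at_top sequentially"
    and "filterlim m at_top sequentially"
    and "(\<lambda>r. real (n r) / real (m r)) \<longlonglongrightarrow> \<alpha>"
  shows "\<exists>p q :: nat \<Rightarrow> real.
           (\<forall>i\<ge>1. (\<lambda>r. age_prob tie (n r) (m r) i) \<longlonglongrightarrow> p i) \<and>
           (\<forall>i\<ge>1. q i = \<alpha> * p i) \<and>
           summable q \<and> summable (tail q) \<and>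
           tail (tail q) 1 = ln (1 / (1 - \<alpha>)) \<and>
           (\<forall>i\<ge>1. tail (tail q) (i + 1) = tail (tail q) i - 1 + exp (- tail (tail q) i))"
proof -
  interpret load_factor \<alpha> n m tie by unfold_locales fact+
  \<comment> \<open>The witness for \<open>q\<close> is \<open>limit_share \<alpha>\<close>. For
    \<open>\<alpha> = 0\<close> it vanishes and the quotient would be 0, whereas in the limit almost
    all keys have age 1.\<close>
  define p where "p i = (if \<alpha> = 0 then of_bool (i = 1) else limit_share \<alpha> i / \<alpha>)" for i :: nat
  have "(\<lambda>r. age_prob tie (n r) (m r) (Suc k)) \<longlonglongrightarrow> p (Suc k)" for k
    using tendsto_age_prob_pos[of k] tendsto_age_prob_zero[of k] \<alpha>_nonneg by (simp add: p_def)
  then have "\<forall>i\<ge>1. (\<lambda>r. age_prob tie (n r) (m r) i) \<longlonglongrightarrow> p i"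
    by (metis Suc_le_D One_nat_def)
  moreover have "limit_share 0 i = 0" for i
  proof -
    have "limit_probes 0 k = 0" for k by (induction k) auto
    then show ?thesis by (simp add: limit_share_def)
  qed
  then have "\<forall>i\<ge>1. limit_share \<alpha> i = \<alpha> * p i" by (simp add: p_def)
  moreover have "tail (tail (limit_share \<alpha>)) 1 = ln (1 / (1 - \<alpha>))"
    using tail_tail_limit_share[OF assms(1,2), of 0] by simp
  moreover have "tail (tail (limit_share \<alpha>)) (i + 1) =
      tail (tail (limit_share \<alpha>)) i - 1 + exp (- tail (tail (limit_share \<alpha>)) i)" if "1 \<le> i" for i
    using tail_tail_limit_share[OF assms(1,2), of i] tail_tail_limit_share[OF assms(1,2), of "i - 1"] that
      limit_probes.simps(2)[of \<alpha> "i - 1"]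
    by (simp del: limit_probes.simps)
  ultimately show ?thesis
    using summable_limit_share[OF assms(1,2)] by blast
qed

end
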